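(* Let $u,v,q$ be complex parameters (generic, so no denominator vanishes). Let $K_6(0)=K_6(1)=K_6(2)=1$ and $K_6(n):=K(q,q^{-n},q^{1-n},q^{2-n},q^{3-n},u,v,q^4)$ for $n\ge3$. Put \[ G_r:=\frac{(q^4u,q^4v,q^5/u,q^5/v;q^4)_r}{(u,v,q/u,q/v;q^4)_r},\qquad H_r:=\frac{(q^3u,q^3v,q^4/u,q^4/v;q^4)_r}{(u/q,v/q,1/u,1/v;q^4)_r}. \] (i) The sequences with $\alpha_0=\beta_0=1$, $\alpha_{4r+2}=0$ ($r\ge0$), and \[ \alpha_{4r}=G_rq^{8r^2-10r}+H_rq^{8r^2-6r}\ (r\ge1),\quad \alpha_{4r+1}=-G_rq^{8r^2-2r+1}\ (r\ge0),\quad \alpha_{4r-1}=-H_rq^{8r^2-14r+1}\ (r\ge1), \] \[ \beta_n=K_6(n)\frac{(-q^2;q^2)_{n-1}}{(q;q)_{2n}}\ (n\ge1), \] form a Bailey pair relative to $a=1$. (ii) The sequences with $\alpha_0=\beta_0=1$, $\alpha_{4r+2}=0$ ($r\ge0$), and \[ \alpha_{4r}=G_rq^{8r^2-6r}+H_rq^{8r^2-10r}\ (r\ge1),\quad \alpha_{4r+1}=-G_rq^{8r^2-6r}\ (r\ge0),\quad \alpha_{4r-1}=-H_rq^{8r^2-10r}\ (r\ge1), \] \[ \beta_n=K_6(n)\frac{q^n(-q^2;q^2)_{n-1}}{(q;q)_{2n}}\ (n\ge1), \] form a Bailey pair relative to $a=1$.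
   Context: Notation: $(x;q)_n=\prod_{k=0}^{n-1}(1-xq^k)$ and $(x_1,\dots,x_k;q)_n=(x_1;q)_n\cdots(x_k;q)_n$. A pair of sequences $(\alpha_n)_{n\ge0},(\beta_n)_{n\ge0}$ is a Bailey pair relative to $a$ if $\alpha_0=1$ and $\beta_n=\sum_{j=0}^{n}\frac{\alpha_j}{(q;q)_{n-j}(aq;q)_{n+j}}$ for all $n\ge0$. The function $K$: for complex $a,b,c,d,e,u,v$ and a base $p$, let $\sigma_1,\dots,\sigma_4$ be the elementary symmetric functions of $b,c,d,e$ and \[ K(a,b,c,d,e,u,v,p):=\frac{uv(\sigma_3-a\sigma_1)(p\sigma_3-a\sigma_1)a^2+(1-p)uv(a^2-\sigma_4)(a^2-\sigma_2a+\sigma_4)a+(u+v)(a+uv)(\sigma_3-a\sigma_1)(a^2-p\sigma_4)a+(u^2+a)(v^2+a)(a^2-\sigma_4)(a^2-p\sigma_4)}{(a^2-bcde)(a^2-bcde\,p)(1-u)(a-u)(1-v)(a-v)}. \] *)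

theory Defs
  imports Complex_Main
begin

definition qpoch :: "complex \<Rightarrow> complex \<Rightarrow> nat \<Rightarrow> complex" where
  "qpoch x q n = (\<Prod>k<n. 1 - x * q ^ k)"

definition qpochs :: "complex list \<Rightarrow> complex \<Rightarrow> nat \<Rightarrow> complex" where
  "qpochs xs q n = (\<Prod>x\<leftarrow>xs. qpoch x q n)"

definition bailey_pair ::
  "complex \<Rightarrow> complex \<Rightarrow> (nat \<Rightarrow> complex) \<Rightarrow> (nat \<Rightarrow> complex) \<Rightarrow> bool" where
  "bailey_pair q a \<alpha> \<beta> \<longleftrightarrow>
     \<alpha> 0 = 1 \<and>
     (\<forall>n. \<beta> n = (\<Sum>j\<le>n. \<alpha> j / (qpoch q q (n - j) * qpoch (a * q) q (n + j))))"

definition K ::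
  "complex \<Rightarrow> complex \<Rightarrow> complex \<Rightarrow> complex \<Rightarrow> complex \<Rightarrow> complex \<Rightarrow> complex \<Rightarrow> complex \<Rightarrow> complex"
  where
  "K a b c d e u v p =
     (let \<sigma>1 = b + c + d + e;
          \<sigma>2 = b * c + b * d + b * e + c * d + c * e + d * e;
          \<sigma>3 = b * c * d + b * c * e + b * d * e + c * d * e;
          \<sigma>4 = b * c * d * e
      in (u * v * (\<sigma>3 - a * \<sigma>1) * (p * \<sigma>3 - a * \<sigma>1) * a\<^sup>2
          + (1 - p) * u * v * (a\<^sup>2 - \<sigma>4) * (a\<^sup>2 - \<sigma>2 * a + \<sigma>4) * a
          + (u + v) * (a + u * v) * (\<sigma>3 - a * \<sigma>1) * (a\<^sup>2 - p * \<sigma>4) * a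
          + (u\<^sup>2 + a) * (v\<^sup>2 + a) * (a\<^sup>2 - \<sigma>4) * (a\<^sup>2 - p * \<sigma>4))
         / ((a\<^sup>2 - b * c * d * e) * (a\<^sup>2 - b * c * d * e * p)
            * (1 - u) * (a - u) * (1 - v) * (a - v)))"

definition K6 :: "complex \<Rightarrow> complex \<Rightarrow> complex \<Rightarrow> nat \<Rightarrow> complex" where
  "K6 q u v n =
     (if n \<le> 2 then 1
      else K q (q powi (- int n)) (q powi (1 - int n)) (q powi (2 - int n)) (q powi (3 - int n))
             u v (q ^ 4))"

definition G :: "complex \<Rightarrow> complex \<Rightarrow> complex \<Rightarrow> nat \<Rightarrow> complex" where
  "G q u v r =
     qpochs [q ^ 4 * u, q ^ 4 * v, q ^ 5 / u, q ^ 5 / v] (q ^ 4) r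
     / qpochs [u, v, q / u, q / v] (q ^ 4) r"

definition H :: "complex \<Rightarrow> complex \<Rightarrow> complex \<Rightarrow> nat \<Rightarrow> complex" where
  "H q u v r =
     qpochs [q ^ 3 * u, q ^ 3 * v, q ^ 4 / u, q ^ 4 / v] (q ^ 4) r
     / qpochs [u / q, v / q, 1 / u, 1 / v] (q ^ 4) r"

(* Exactly the non-vanishing of all denominators.  Those of K6 need no separate clause:
   1 - u, q - u, 1 - v, q - v are nonzero by the third line with r = 1 (as u, v are nonzero),
   and for n >= 3 the factors q^2 - q^(6-4n), q^2 - q^(10-4n) are nonzero since
   the second line says that q is not a root of unity. *)
definition generic_params :: "complex \<Rightarrow> complex \<Rightarrow> complex \<Rightarrow> bool" where
  "generic_params q u v \<longleftrightarrow>
     q \<noteq> 0 \<and> u \<noteq> 0 \<and> v \<noteq> 0 \<and>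
     (\<forall>n. qpoch q q n \<noteq> 0) \<and>
     (\<forall>r. qpochs [u, v, q / u, q / v] (q ^ 4) r \<noteq> 0) \<and>
     (\<forall>r. qpochs [u / q, v / q, 1 / u, 1 / v] (q ^ 4) r \<noteq> 0)"

end

theory Submission
  imports Defs "HOL-Library.Groups_Big_Fun"
begin

text \<open>
  The quotient \<open>(p x; p)\<^sub>r / (x; p)\<^sub>r = (1 - x p\<^sup>r) / (1 - x)\<close> makes sense for all integers \<open>r\<close>.
  Read this way, \<open>H\<^sub>r\<close> is \<open>q\<^bsup>16 r\<^esup> G\<^bsub>- r\<^esub>\<close>, so that both Bailey sums fold into one sum over the
  integers, the second being \<open>q\<^sup>n\<close> times the first. In terms of \<open>z = q\<^bsup>- 4 s\<^esup> + q\<^bsup>4 s + 1\<^esup>\<close> its summand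
  is a quadratic polynomial in \<open>z\<close>, which carries all of \<open>u\<close> and \<open>v\<close>, times a very-well-poised
  term. For such a term, telescoping two suitable multiples expresses the sums with weights \<open>z\<close>
  and \<open>z\<^sup>2\<close> by the sum with weight 1, and \<open>K\<close> is the factor that results. The remaining sum over
  the multiples of 4 is cut out of a finite Jacobi triple product by the fourth roots of unity:
  \<open>1\<close> and \<open>- 1\<close> contribute nothing, and \<open>\<i>\<close> and \<open>- \<i>\<close> contribute the product \<open>(- q\<^sup>2; q\<^sup>2)\<^bsub>n - 1\<^esub>\<close>.
\<close>

no_notation suminf (binder "\<Sum>" 10)

subsection \<open>Finitely supported sums over the integers\<close>

lemma Sum_any_shift:
  fixes F :: "int \<Rightarrow> 'a :: comm_monoid_add"
  shows "(\<Sum>j. F (j + k)) = (\<Sum>j. F j)"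
  by (rule Sum_any.reindex_cong[OF bij_plus_right[of k], symmetric]) (simp add: fun_eq_iff)

lemma finite_support_shift:
  fixes F :: "int \<Rightarrow> 'a :: zero"
  assumes "finite {j. F j \<noteq> 0}"
  shows "finite {j. F (j + k) \<noteq> 0}"
proof -
  have "{j. F (j + k) \<noteq> 0} = (\<lambda>j. j - k) ` {j. F j \<noteq> 0}"
    by (auto simp: image_iff intro!: exI[of _ "_ + k"])
  then show ?thesis
    using assms by simp
qed

lemma Sum_any_diff:
  fixes F G :: "'a \<Rightarrow> 'b :: ab_group_add"
  assumes "finite {j. F j \<noteq> 0}" "finite {j. G j \<noteq> 0}"
  shows "(\<Sum>j. F j - G j) = (\<Sum>j. F j) - (\<Sum>j. G j)"
proof -
  have "(\<Sum>j. - G j) = - (\<Sum>j. G j)"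
    by (simp add: Sum_any.expand_set sum_negf)
  then show ?thesis
    using Sum_any.distrib[of F "\<lambda>j. - G j"] assms by simp
qed

lemma Sum_any_telescope:
  fixes F :: "int \<Rightarrow> 'a :: ab_group_add"
  assumes "finite {j. F j \<noteq> 0}"
  shows "(\<Sum>j. F (j + 1) - F j) = 0"
  using assms by (simp add: Sum_any_diff finite_support_shift Sum_any_shift)

lemma Sum_any_multiples:
  fixes F :: "int \<Rightarrow> 'a :: comm_monoid_add"
  assumes "m \<noteq> 0"
  shows "(\<Sum>s. F (m * s)) = (\<Sum>j. if m dvd j then F j else 0)"
proof -
  have "bij_betw ((*) m) {s. F (m * s) \<noteq> 0} {j. (if m dvd j then F j else 0) \<noteq> 0}"
    using assms by (auto simp: bij_betw_def inj_on_def image_iff split: if_splits)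
  then have "(\<Sum>j\<in>{j. (if m dvd j then F j else 0) \<noteq> 0}. if m dvd j then F j else 0)
      = (\<Sum>s\<in>{s. F (m * s) \<noteq> 0}. if m dvd m * s then F (m * s) else 0)"
    by (rule sum.reindex_bij_betw[symmetric])
  then show ?thesis
    by (simp add: Sum_any.expand_set)
qed

lemma sum_powers_of_root_of_unity:
  fixes \<omega> :: "'a :: field"
  assumes "\<omega> ^ m = 1" "\<And>k. 0 < k \<Longrightarrow> k < m \<Longrightarrow> \<omega> ^ k \<noteq> 1" "m > 0"
  shows "(\<Sum>k<m. (\<omega> ^ k) powi j) = (if int m dvd j then of_nat m else 0)"
proof -
  have "\<omega> \<noteq> 0"
    using assms(1,3) by (auto simp: power_0_left)
  define r where "r = nat (j mod int m)"
  have r: "int r = j mod int m" "r < m"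
    using \<open>m > 0\<close> by (simp_all add: r_def nat_less_iff)
  have "\<omega> powi (int m * (j div int m) + int r) = (\<omega> ^ m) powi (j div int m) * \<omega> ^ r"
    using \<open>\<omega> \<noteq> 0\<close> by (simp only: power_int_add power_int_mult power_int_of_nat simp_thms)
  then have powi_j: "\<omega> powi j = \<omega> ^ r"
    using assms(1) by (simp add: r)
  have "(\<Sum>k<m. (\<omega> ^ k) powi j) = (\<Sum>k<m. (\<omega> powi j) ^ k)"
    by (simp add: power_int_power power_int_power' mult.commute)
  also have "\<dots> = (if r = 0 then of_nat m else 0)"
  proof (cases "r = 0")
    case False
    then have "\<omega> ^ r \<noteq> 1"
      using assms(2) \<open>r < m\<close> by simp
    moreover have "(\<omega> ^ r) ^ m = (\<omega> ^ m) ^ r"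
      by (simp only: mult.commute flip: power_mult)
    ultimately show ?thesis
      using False assms(1) by (simp add: powi_j geometric_sum)
  qed (simp add: powi_j)
  also have "r = 0 \<longleftrightarrow> int m dvd j"
    using r(1) by (simp add: dvd_eq_mod_eq_0 flip: r(1))
  finally show ?thesis .
qed

lemma roots_of_unity_filter:
  fixes \<omega> :: "'a :: field" and F :: "int \<Rightarrow> 'a"
  assumes "\<omega> ^ m = 1" "\<And>k. 0 < k \<Longrightarrow> k < m \<Longrightarrow> \<omega> ^ k \<noteq> 1" "m > 0"
    and "finite {j. F j \<noteq> 0}"
  shows "of_nat m * (\<Sum>s. F (int m * s)) = (\<Sum>k<m. \<Sum>j. (\<omega> ^ k) powi j * F j)"
proof -
  define A where "A = {j. F j \<noteq> 0}"
  have on_A: "(\<Sum>j. g j * F j) = (\<Sum>j\<in>A. g j * F j)" for g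
    using assms(4) by (intro Sum_any.expand_superset) (auto simp: A_def)
  have "(\<Sum>s. F (int m * s)) = (\<Sum>j. (if int m dvd j then 1 else 0) * F j)"
    using \<open>m > 0\<close> by (subst Sum_any_multiples) (auto intro!: arg_cong[where f = Sum_any])
  then have "of_nat m * (\<Sum>s. F (int m * s)) = (\<Sum>j\<in>A. (if int m dvd j then of_nat m else 0) * F j)"
    unfolding on_A by (auto simp: sum_distrib_left intro!: sum.cong)
  also have "\<dots> = (\<Sum>j\<in>A. \<Sum>k<m. (\<omega> ^ k) powi j * F j)"
    using sum_powers_of_root_of_unity[OF assms(1-3)] by (simp flip: sum_distrib_right)
  also have "\<dots> = (\<Sum>k<m. \<Sum>j\<in>A. (\<omega> ^ k) powi j * F j)"
    by (rule sum.swap)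
  finally show ?thesis
    unfolding on_A .
qed

lemma sum_blocks_of_4_eq_int_sum:
  fixes a :: "nat \<Rightarrow> 'a :: comm_monoid_add" and F :: "int \<Rightarrow> 'a"
  assumes "F 0 = a 0 + a 1"
    and "\<And>r. F (int (Suc r)) + F (- int (Suc r))
      = a (4 * r + 2) + a (4 * r + 3) + a (4 * r + 4) + a (4 * r + 5)"
  shows "(\<Sum>j\<le>4 * m + 1. a j) = (\<Sum>s\<in>{- int m..int m}. F s)"
proof (induction m)
  case 0
  then show ?case using assms(1) by simp
next
  case (Suc m)
  have "{- int (Suc m)..int (Suc m)}
      = insert (int (Suc m)) (insert (- int (Suc m)) {- int m..int m})"
    by (simp only: set_eq_iff atLeastAtMost_iff insert_iff of_nat_Suc) linarith
  then have "(\<Sum>s\<in>{- int (Suc m)..int (Suc m)}. F s)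
      = (F (int (Suc m)) + F (- int (Suc m))) + (\<Sum>s\<in>{- int m..int m}. F s)"
    by (simp add: add.assoc)
  also have "\<dots> = (\<Sum>j\<le>4 * m + 1. a j)
      + a (4 * m + 2) + a (4 * m + 3) + a (4 * m + 4) + a (4 * m + 5)"
    unfolding assms(2) Suc.IH by (simp only: add_ac)
  also have "\<dots> = (\<Sum>j\<le>Suc (Suc (Suc (Suc (4 * m + 1)))). a j)"
    by (simp only: sum.atMost_Suc) (simp add: numeral_eq_Suc)
  also have "Suc (Suc (Suc (Suc (4 * m + 1)))) = 4 * Suc m + 1"
    by simp
  finally show ?case ..
qed

subsection \<open>Well-poised bilateral sums\<close>

definition shift_quot :: "complex \<Rightarrow> complex \<Rightarrow> int \<Rightarrow> complex" where
  "shift_quot p x s = (1 - x * p powi s) / (1 - x)"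

definition wp_quot :: "complex \<Rightarrow> complex \<Rightarrow> complex \<Rightarrow> complex \<Rightarrow> int \<Rightarrow> complex" where
  "wp_quot p a u v s =
     shift_quot p u s * shift_quot p v s * shift_quot p (a / u) s * shift_quot p (a / v) s"

lemma shift_quot_inverse:
  assumes "p \<noteq> 0" "x \<noteq> 0"
  shows "shift_quot p (1 / x) s = p powi s * shift_quot p x (- s)"
proof (cases "x = 1")
  case False
  have "p powi s \<noteq> 0" using assms by simp
  then show ?thesis
    using assms False by (simp add: shift_quot_def power_int_minus_divide divide_simps) algebra
qed (simp add: shift_quot_def)

lemma wp_quot_0:
  assumes "u \<noteq> 1" "u \<noteq> a" "v \<noteq> 1" "v \<noteq> a"
  shows "wp_quot p a u v 0 = 1"
proof -
  have "a / u \<noteq> 1" "a / v \<noteq> 1"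
    using assms by (auto simp: divide_eq_eq)
  then show ?thesis
    using assms by (simp add: wp_quot_def shift_quot_def)
qed

text \<open>
  The ratio \<open>f (s + 1) / f s\<close> is that of Bailey's \<open>\<^sub>6\<psi>\<^sub>6\<close> series to the base \<open>p\<close> without its
  very-well-poised factor \<open>1 - a p\<^bsup>2 s\<^esup>\<close>.
\<close>
locale well_poised =
  fixes p a b c d e :: complex and f :: "int \<Rightarrow> complex"
  assumes base_nonzero: "p \<noteq> 0"
    and finite_support: "finite {s. f s \<noteq> 0}"
    and term_ratio: "\<And>s. f (s + 1) * ((b - a * p powi (s + 1)) * (c - a * p powi (s + 1))
        * (d - a * p powi (s + 1)) * (e - a * p powi (s + 1)))
      = a\<^sup>2 * p * ((1 - b * p powi s) * (1 - c * p powi s)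
        * (1 - d * p powi s) * (1 - e * p powi s)) * f s"
begin

definition \<sigma>1 :: complex where "\<sigma>1 = b + c + d + e"
definition \<sigma>2 :: complex where "\<sigma>2 = b * c + b * d + b * e + c * d + c * e + d * e"
definition \<sigma>3 :: complex where "\<sigma>3 = b * c * d + b * c * e + b * d * e + c * d * e"
definition \<sigma>4 :: complex where "\<sigma>4 = b * c * d * e"

abbreviation "upper y \<equiv> (1 - b * y) * (1 - c * y) * (1 - d * y) * (1 - e * y)"
abbreviation "lower y \<equiv> (b - a * y) * (c - a * y) * (d - a * y) * (e - a * y)"

lemma upper_expand: "upper y = 1 - \<sigma>1 * y + \<sigma>2 * y\<^sup>2 - \<sigma>3 * y ^ 3 + \<sigma>4 * y ^ 4"
  unfolding \<sigma>1_def \<sigma>2_def \<sigma>3_def \<sigma>4_def by algebra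

lemma lower_expand:
  "lower y = \<sigma>4 - a * \<sigma>3 * y + a\<^sup>2 * \<sigma>2 * y\<^sup>2 - a ^ 3 * \<sigma>1 * y ^ 3 + a ^ 4 * y ^ 4"
  unfolding \<sigma>1_def \<sigma>2_def \<sigma>3_def \<sigma>4_def by algebra

definition node :: "complex \<Rightarrow> complex" where
  "node y = 1 / y + a * y"

definition vwp_term :: "int \<Rightarrow> complex" where
  "vwp_term s = (1 - a * (p powi s)\<^sup>2) * f s"

definition moment :: "nat \<Rightarrow> complex" where
  "moment k = (\<Sum>s. node (p powi s) ^ k * vwp_term s)"

lemma moment_linear_combination:
  "(\<Sum>s. (x * (node (p powi s))\<^sup>2 + y * node (p powi s) + z) * vwp_term s)
    = x * moment 2 + y * moment 1 + z * moment 0"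
proof -
  have on_support: "(\<Sum>s. g s * vwp_term s) = (\<Sum>s\<in>{s. f s \<noteq> 0}. g s * vwp_term s)" for g
    using finite_support by (rule Sum_any.expand_superset) (auto simp: vwp_term_def)
  show ?thesis
    unfolding moment_def on_support
    by (simp add: sum_distrib_left distrib_right sum.distrib mult.assoc)
qed

lemma telescoping_sum_eq_0:
  fixes g h :: "complex \<Rightarrow> complex"
  assumes "\<And>y. y \<noteq> 0 \<Longrightarrow> y * (1 - a * y\<^sup>2) * h y = a\<^sup>2 * upper y * g (p * y) - lower y * g y"
  shows "(\<Sum>s. h (p powi s) * vwp_term s) = 0"
proof -
  define F where "F s = lower (p powi s) * g (p powi s) * f s / p powi s" for s
  have "F (s + 1) - F s = h (p powi s) * vwp_term s" for s
  proof -
    have "F (s + 1) = (f (s + 1) * lower (p powi (s + 1))) * g (p powi (s + 1)) / p powi (s + 1)"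
      by (simp only: F_def mult_ac)
    also have "\<dots> = a\<^sup>2 * upper (p powi s) * g (p * p powi s) * f s / p powi s"
      unfolding term_ratio using base_nonzero by (simp add: power_int_add mult.commute)
    finally have "F (s + 1) - F s
        = (a\<^sup>2 * upper (p powi s) * g (p * p powi s) - lower (p powi s) * g (p powi s))
          * f s / p powi s"
      by (simp only: F_def flip: left_diff_distrib diff_divide_distrib)
    also have "\<dots> = h (p powi s) * vwp_term s"
      using base_nonzero by (simp add: vwp_term_def flip: assms)
    finally show ?thesis .
  qed
  moreover have "finite {s. F s \<noteq> 0}"
    by (rule finite_subset[OF _ finite_support]) (auto simp: F_def)
  ultimately show ?thesis
    using Sum_any_telescope[of F] by simp
qed

lemma first_moment: "(a\<^sup>2 - \<sigma>4) * moment 1 = a * (a * \<sigma>1 - \<sigma>3) * moment 0"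
proof -
  have "(\<Sum>s. (0 * (node (p powi s))\<^sup>2 + (a\<^sup>2 - \<sigma>4) * node (p powi s) + a * (\<sigma>3 - a * \<sigma>1))
      * vwp_term s) = 0"
  proof (rule telescoping_sum_eq_0)
    fix y :: complex
    assume "y \<noteq> 0"
    then show "y * (1 - a * y\<^sup>2) * (0 * (node y)\<^sup>2 + (a\<^sup>2 - \<sigma>4) * node y + a * (\<sigma>3 - a * \<sigma>1))
        = a\<^sup>2 * upper y * 1 - lower y * 1"
      unfolding upper_expand lower_expand by (simp add: node_def divide_simps) algebra
  qed
  then show ?thesis
    unfolding moment_linear_combination by algebra
qed

lemma second_moment:
  "(a\<^sup>2 - p * \<sigma>4) * moment 2
    = a * (a * \<sigma>1 - p * \<sigma>3) * moment 1 + (1 - p) * a * (a\<^sup>2 - \<sigma>2 * a + \<sigma>4) * moment 0"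
proof -
  have "(\<Sum>s. ((a\<^sup>2 - p * \<sigma>4) * (node (p powi s))\<^sup>2 + a * (p * \<sigma>3 - a * \<sigma>1) * node (p powi s)
      + (p - 1) * a * (a\<^sup>2 - \<sigma>2 * a + \<sigma>4)) * vwp_term s) = 0"
    \<comment> \<open>The weight \<open>p / y + a * y\<close> is invariant under \<open>y \<mapsto> p / (a * y)\<close>; this makes the
      difference divisible by \<open>1 - a * y\<^sup>2\<close>.\<close>
  proof (rule telescoping_sum_eq_0)
    fix y :: complex
    assume "y \<noteq> 0"
    then show "y * (1 - a * y\<^sup>2) * ((a\<^sup>2 - p * \<sigma>4) * (node y)\<^sup>2 + a * (p * \<sigma>3 - a * \<sigma>1) * node y
        + (p - 1) * a * (a\<^sup>2 - \<sigma>2 * a + \<sigma>4))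
        = a\<^sup>2 * upper y * (p / (p * y) + a * (p * y)) - lower y * (p / y + a * y)"
      using base_nonzero unfolding upper_expand lower_expand
      by (simp add: node_def divide_simps) algebra
  qed
  then show ?thesis
    unfolding moment_linear_combination by algebra
qed

lemma moments_eq_K:
  assumes "a\<^sup>2 \<noteq> \<sigma>4" "a\<^sup>2 \<noteq> \<sigma>4 * p"
    and "u \<noteq> 1" "u \<noteq> a" "v \<noteq> 1" "v \<noteq> a"
  shows "u * v * moment 2 - (u + v) * (a + u * v) * moment 1 + (u\<^sup>2 + a) * (v\<^sup>2 + a) * moment 0
    = (1 - u) * (a - u) * (1 - v) * (a - v) * K a b c d e u v p * moment 0"
proof -
  define N where "N = u * v * (\<sigma>3 - a * \<sigma>1) * (p * \<sigma>3 - a * \<sigma>1) * a\<^sup>2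
          + (1 - p) * u * v * (a\<^sup>2 - \<sigma>4) * (a\<^sup>2 - \<sigma>2 * a + \<sigma>4) * a
          + (u + v) * (a + u * v) * (\<sigma>3 - a * \<sigma>1) * (a\<^sup>2 - p * \<sigma>4) * a
          + (u\<^sup>2 + a) * (v\<^sup>2 + a) * (a\<^sup>2 - \<sigma>4) * (a\<^sup>2 - p * \<sigma>4)"
  define D where "D = (a\<^sup>2 - \<sigma>4) * (a\<^sup>2 - \<sigma>4 * p)"
  have "K a b c d e u v p = N / (D * (1 - u) * (a - u) * (1 - v) * (a - v))"
    unfolding K_def Let_def N_def D_def \<sigma>1_def \<sigma>2_def \<sigma>3_def \<sigma>4_def ..
  then have "(1 - u) * (a - u) * (1 - v) * (a - v) * K a b c d e u v p = N / D"
    using assms(3-) by simp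
  moreover have "N * moment 0
      = D * (u * v * moment 2 - (u + v) * (a + u * v) * moment 1
        + (u\<^sup>2 + a) * (v\<^sup>2 + a) * moment 0)"
    using first_moment second_moment unfolding N_def D_def by algebra
  ultimately show ?thesis
    using assms by (simp add: D_def)
qed

lemma wp_quot_eq_node:
  assumes "u \<noteq> 0" "v \<noteq> 0" "u \<noteq> 1" "u \<noteq> a" "v \<noteq> 1" "v \<noteq> a"
  shows "(1 - u) * (a - u) * (1 - v) * (a - v) * (wp_quot p a u v s / (p powi s)\<^sup>2)
    = u * v * (node (p powi s))\<^sup>2 - (u + v) * (a + u * v) * node (p powi s) + (u\<^sup>2 + a) * (v\<^sup>2 + a)"
proof -
  define y where "y = p powi s"
  have "y \<noteq> 0" using base_nonzero by (simp add: y_def)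
  have pair: "(1 - x) * (x - a) * (shift_quot p x s * shift_quot p (a / x) s)
      = y * (x * node y - (x\<^sup>2 + a))"
    if "x \<noteq> 0" "x \<noteq> 1" "x \<noteq> a" for x
  proof -
    have "1 - a / x \<noteq> 0" using that by simp
    then show ?thesis
      using that \<open>y \<noteq> 0\<close> unfolding shift_quot_def node_def y_def[symmetric]
      by (simp add: divide_simps) algebra
  qed
  have "(1 - u) * (a - u) * (1 - v) * (a - v) * (wp_quot p a u v s / y\<^sup>2)
      = ((1 - u) * (u - a) * (shift_quot p u s * shift_quot p (a / u) s))
        * ((1 - v) * (v - a) * (shift_quot p v s * shift_quot p (a / v) s)) / y\<^sup>2"
    unfolding wp_quot_def times_divide_eq_right by (rule arg_cong2[OF _ refl]) algebra
  also have "\<dots> = (u * node y - (u\<^sup>2 + a)) * (v * node y - (v\<^sup>2 + a))"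
    unfolding pair[OF assms(1,3,4)] pair[OF assms(2,5,6)]
    using \<open>y \<noteq> 0\<close> by (simp add: power2_eq_square)
  finally show ?thesis
    unfolding y_def by algebra
qed

theorem well_poised_sum_K:
  assumes "a\<^sup>2 \<noteq> \<sigma>4" "a\<^sup>2 \<noteq> \<sigma>4 * p"
    and uv: "u \<noteq> 0" "v \<noteq> 0" "u \<noteq> 1" "u \<noteq> a" "v \<noteq> 1" "v \<noteq> a"
  shows "(\<Sum>s. wp_quot p a u v s / (p powi s)\<^sup>2 * vwp_term s) = K a b c d e u v p * (\<Sum>s. vwp_term s)"
proof -
  define E where "E = (1 - u) * (a - u) * (1 - v) * (a - v)"
  have "E \<noteq> 0" using uv by (simp add: E_def)
  have "wp_quot p a u v s / (p powi s)\<^sup>2 = u * v / E * (node (p powi s))\<^sup>2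
      + - ((u + v) * (a + u * v) / E) * node (p powi s) + (u\<^sup>2 + a) * (v\<^sup>2 + a) / E" for s
    using arg_cong[OF wp_quot_eq_node[OF uv, of s], of "\<lambda>x. x / E"] \<open>E \<noteq> 0\<close>
    by (simp add: add_divide_distrib diff_divide_distrib flip: E_def)
  then have "(\<Sum>s. wp_quot p a u v s / (p powi s)\<^sup>2 * vwp_term s)
      = (u * v * moment 2 - (u + v) * (a + u * v) * moment 1
        + (u\<^sup>2 + a) * (v\<^sup>2 + a) * moment 0) / E"
    by (simp only: moment_linear_combination) (simp add: add_divide_distrib diff_divide_distrib)
  also have "\<dots> = K a b c d e u v p * moment 0"
    unfolding moments_eq_K[OF assms(1,2) uv(3-6)] E_def[symmetric] using \<open>E \<noteq> 0\<close> by simp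
  finally show ?thesis
    by (simp add: moment_def)
qed

end

subsection \<open>A finite form of the Jacobi triple product\<close>

lemma qpoch_0 [simp]: "qpoch x q 0 = 1"
  by (simp add: qpoch_def)

lemma qpoch_Suc: "qpoch x q (Suc n) = qpoch x q n * (1 - x * q ^ n)"
  by (simp add: qpoch_def)

lemma qpoch_mult_minus: "qpoch x q n * qpoch (- x) q n = qpoch (x\<^sup>2) (q\<^sup>2) n"
  by (simp add: qpoch_def algebra_simps power_mult power2_eq_square power_mult_distrib
      flip: prod.distrib)

lemma qpoch_Suc_left: "qpoch x q (Suc n) = (1 - x) * qpoch (x * q) q n"
  by (simp add: qpoch_def prod.lessThan_Suc_shift mult.assoc del: prod.lessThan_Suc)

definition tri :: "int \<Rightarrow> int" where
  "tri j = j * (j - 1) div 2"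

lemma tri_0 [simp]: "tri 0 = 0"
  by (simp add: tri_def)

lemma tri_Suc: "tri (j + 1) = tri j + j"
proof -
  have "(j + 1) * (j + 1 - 1) = j * (j - 1) + j * 2"
    by (simp add: algebra_simps)
  then show ?thesis
    by (simp add: tri_def)
qed

lemma tri_4: "tri (4 * s) = 8 * s\<^sup>2 - 2 * s"
proof -
  have "4 * s * (4 * s - 1) = (8 * s\<^sup>2 - 2 * s) * 2"
    by (simp add: algebra_simps power2_eq_square)
  then show ?thesis
    unfolding tri_def by simp
qed

lemma tri_pred: "tri (j - 1) = tri j - j + 1"
  using tri_Suc[of "j - 1"] by simp

lemma tri_minus: "tri (- j) = tri j + j"
  using tri_Suc[of j] by (simp add: tri_def algebra_simps)

locale non_root_of_unity =
  fixes q :: complex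
  assumes q_nonzero: "q \<noteq> 0"
    and power_neq_1: "\<And>k. k \<ge> 1 \<Longrightarrow> q ^ k \<noteq> 1"
begin

lemma powi_eq_1_iff: "q powi k = 1 \<longleftrightarrow> k = 0"
proof
  assume "q powi k = 1"
  then have "q ^ nat \<bar>k\<bar> = 1"
    by (cases "k \<ge> 0") (auto simp: power_int_def power_inverse)
  then show "k = 0"
    using power_neq_1[of "nat \<bar>k\<bar>"] by linarith
qed simp

lemma powi_eq_iff: "q powi j = q powi k \<longleftrightarrow> j = k"
  using powi_eq_1_iff[of "j - k"] q_nonzero by (simp add: power_int_diff)

lemma qpoch_nonzero: "qpoch q q n \<noteq> 0"
  using power_neq_1[of "Suc _"] by (simp add: qpoch_def)

definition inv_qfact :: "int \<Rightarrow> complex" where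
  "inv_qfact k = (if k < 0 then 0 else 1 / qpoch q q (nat k))"

lemma inv_qfact_neg [simp]: "k < 0 \<Longrightarrow> inv_qfact k = 0"
  by (simp add: inv_qfact_def)

lemma inv_qfact_of_nat: "inv_qfact (int n) = 1 / qpoch q q n"
  by (simp add: inv_qfact_def)

lemma inv_qfact_pred: "inv_qfact (k - 1) = (1 - q powi k) * inv_qfact k"
proof (cases k rule: int_cases3)
  case (pos n)
  then obtain m where k: "k = int (Suc m)"
    by (cases n) auto
  have "1 - q ^ Suc m \<noteq> 0"
    using power_neq_1[of "Suc m"] by simp
  moreover have "k - 1 = int m"
    using k by simp
  ultimately show ?thesis
    unfolding k by (simp only: inv_qfact_of_nat qpoch_Suc power_int_of_nat power_Suc) simp
qed auto

definition bailey_kernel :: "nat \<Rightarrow> nat \<Rightarrow> int \<Rightarrow> complex" where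
  "bailey_kernel m n j = inv_qfact (int m - j) * inv_qfact (int n + j)"

lemma bailey_kernel_eq_0: "j < - int n \<or> int m < j \<Longrightarrow> bailey_kernel m n j = 0"
  by (auto simp: bailey_kernel_def)

lemma bailey_kernel_lower_left:
  "bailey_kernel m n j = (1 - q powi (int m + 1 - j)) * bailey_kernel (Suc m) n j"
  "bailey_kernel m n (j - 1) = (1 - q powi (int n + j)) * bailey_kernel (Suc m) n j"
proof -
  have "inv_qfact (int m - j) = (1 - q powi (int m + 1 - j)) * inv_qfact (int (Suc m) - j)"
    using inv_qfact_pred[of "int m + 1 - j"] by (simp add: algebra_simps)
  then show "bailey_kernel m n j = (1 - q powi (int m + 1 - j)) * bailey_kernel (Suc m) n j"
    by (simp add: bailey_kernel_def)
  have "int m - (j - 1) = int (Suc m) - j" "int n + (j - 1) = int n + j - 1"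
    by simp_all
  then show "bailey_kernel m n (j - 1) = (1 - q powi (int n + j)) * bailey_kernel (Suc m) n j"
    by (simp only: bailey_kernel_def inv_qfact_pred mult.left_commute)
qed

lemma bailey_kernel_minus: "bailey_kernel m n (- j) = bailey_kernel n m j"
  by (simp add: bailey_kernel_def mult.commute)

lemma bailey_kernel_lower_right:
  "bailey_kernel m n j = (1 - q powi (int n + 1 + j)) * bailey_kernel m (Suc n) j"
  "bailey_kernel m n (j + 1) = (1 - q powi (int m - j)) * bailey_kernel m (Suc n) j"
  using bailey_kernel_lower_left[of n m "- j"] bailey_kernel_minus[of n m "j + 1"]
  by (simp_all add: bailey_kernel_minus)

lemma bailey_kernel_ratio:
  "(1 - q powi (int n + 1 + j)) * bailey_kernel m n (j + 1)
    = (1 - q powi (int m - j)) * bailey_kernel m n j"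
proof -
  have "(1 - q powi (int n + 1 + j)) * inv_qfact (int n + (j + 1)) = inv_qfact (int n + j)"
    using inv_qfact_pred[of "int n + 1 + j"] by (simp add: add_ac)
  moreover have "inv_qfact (int m - (j + 1)) = (1 - q powi (int m - j)) * inv_qfact (int m - j)"
    using inv_qfact_pred[of "int m - j"] by (simp add: algebra_simps)
  ultimately show ?thesis
    by (simp add: bailey_kernel_def mult.left_commute)
qed

definition theta_term :: "nat \<Rightarrow> nat \<Rightarrow> int \<Rightarrow> complex" where
  "theta_term m n j = q powi tri j * bailey_kernel m n j"

definition theta_sum :: "nat \<Rightarrow> nat \<Rightarrow> complex \<Rightarrow> complex" where
  "theta_sum m n x = (\<Sum>j. x powi j * theta_term m n j)"

lemma theta_term_eq_0: "j < - int n \<or> int m < j \<Longrightarrow> theta_term m n j = 0"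
  by (auto simp: theta_term_def bailey_kernel_eq_0)

lemma finite_theta_term: "finite {j. theta_term m n j \<noteq> 0}"
proof (rule finite_subset)
  have "theta_term m n j = 0" if "j \<notin> {- int n..int m}" for j
    using that by (auto intro!: theta_term_eq_0)
  then show "{j. theta_term m n j \<noteq> 0} \<subseteq> {- int n..int m}"
    by blast
qed simp

lemma theta_term_Suc_left:
  "(1 - q ^ Suc (m + n)) * theta_term (Suc m) n j
    = theta_term m n j + q ^ m * theta_term m n (j - 1)"
proof -
  define y z where "y = q powi (int m + 1 - j)" and "z = q powi (int n + j)"
  have yz: "q ^ Suc (m + n) = y * z"
    using q_nonzero by (simp add: y_def z_def add_ac flip: power_int_add power_int_of_nat)
  have shift: "q ^ m * q powi tri (j - 1) = y * q powi tri j"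
    using q_nonzero by (simp add: y_def tri_pred algebra_simps flip: power_int_add power_int_of_nat)
  have "theta_term m n j + q ^ m * theta_term m n (j - 1)
      = (q powi tri j * (1 - y) + (q ^ m * q powi tri (j - 1)) * (1 - z))
        * bailey_kernel (Suc m) n j"
    unfolding theta_term_def bailey_kernel_lower_left[of m n j] y_def z_def
    by (simp add: algebra_simps)
  also have "\<dots> = (1 - y * z) * theta_term (Suc m) n j"
    unfolding shift theta_term_def by algebra
  finally show ?thesis
    by (simp only: yz)
qed

lemma theta_sum_Suc_left:
  assumes "x \<noteq> 0"
  shows "(1 - q ^ Suc (m + n)) * theta_sum (Suc m) n x = (1 + x * q ^ m) * theta_sum m n x"
proof -
  define F where "F j = x powi j * theta_term m n j" for j
  have finite_F: "finite {j. F j \<noteq> 0}"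
    by (rule finite_subset[OF _ finite_theta_term]) (auto simp: F_def)
  have summand: "(1 - q ^ Suc (m + n)) * (x powi j * theta_term (Suc m) n j)
      = F j + x * q ^ m * F (j - 1)" for j
  proof -
    have "(1 - q ^ Suc (m + n)) * (x powi j * theta_term (Suc m) n j)
        = x powi j * (theta_term m n j + q ^ m * theta_term m n (j - 1))"
      by (simp only: mult.left_commute flip: theta_term_Suc_left)
    then show ?thesis
      using assms by (simp add: F_def distrib_left power_int_diff)
  qed
  have "(1 - q ^ Suc (m + n)) * theta_sum (Suc m) n x = (\<Sum>j. F j + x * q ^ m * F (j - 1))"
    unfolding theta_sum_def summand[symmetric]
    by (rule Sum_any_right_distrib, rule finite_subset[OF _ finite_theta_term]) auto
  also have "\<dots> = (\<Sum>j. F j) + (\<Sum>j. x * q ^ m * F (j - 1))"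
    using finite_F finite_support_shift[OF finite_F, of "- 1"] by (intro Sum_any.distrib) simp_all
  also have "(\<Sum>j. x * q ^ m * F (j - 1)) = x * q ^ m * (\<Sum>j. F j)"
    using finite_support_shift[OF finite_F, of "- 1"] Sum_any_shift[of F "- 1"]
    by (simp flip: Sum_any_right_distrib)
  finally show ?thesis
    by (simp add: theta_sum_def F_def distrib_right)
qed

lemma theta_sum_reflect:
  assumes "x \<noteq> 0"
  shows "theta_sum m n x = theta_sum n m (q / x)"
proof -
  have "x powi (- j) * theta_term m n (- j) = (q / x) powi j * theta_term n m j" for j
    using q_nonzero by (simp add: theta_term_def bailey_kernel_minus tri_minus power_int_add
        power_int_minus_divide power_int_divide_distrib)
  then show ?thesis
    unfolding theta_sum_def by (intro Sum_any.reindex_cong[OF bij_uminus]) (simp add: fun_eq_iff)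
qed

lemma theta_sum_eq_theta_sum_0:
  assumes "x \<noteq> 0"
  shows "qpoch q q (m + n) * theta_sum m n x = qpoch (- x) q m * (qpoch q q n * theta_sum 0 n x)"
proof (induction m)
  case (Suc m)
  have "qpoch q q (Suc m + n) * theta_sum (Suc m) n x
      = qpoch q q (m + n) * ((1 - q ^ Suc (m + n)) * theta_sum (Suc m) n x)"
    by (simp add: qpoch_Suc)
  also have "\<dots> = qpoch (- x) q (Suc m) * (qpoch q q n * theta_sum 0 n x)"
    unfolding theta_sum_Suc_left[OF assms] using Suc by (simp add: qpoch_Suc)
  finally show ?case .
qed simp

lemma theta_sum_0_0: "theta_sum 0 0 x = 1"
proof -
  have "x powi j * theta_term 0 0 j = (if j = 0 then 1 else 0)" for j
    using inv_qfact_of_nat[of 0] by (auto simp: theta_term_def bailey_kernel_def inv_qfact_def)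
  then show ?thesis
    by (simp add: theta_sum_def)
qed

theorem finite_triple_product:
  assumes "x \<noteq> 0"
  shows "theta_sum m n x = qpoch (- x) q m * qpoch (- (q / x)) q n / qpoch q q (m + n)"
proof -
  have "qpoch q q n * theta_sum 0 n x = qpoch (- (q / x)) q n"
    using theta_sum_eq_theta_sum_0[of "q / x" n 0] assms q_nonzero
    by (simp add: theta_sum_reflect[of x 0] theta_sum_0_0)
  then show ?thesis
    using theta_sum_eq_theta_sum_0[OF assms, of m n] qpoch_nonzero by (simp add: field_simps)
qed

definition wp_term :: "nat \<Rightarrow> int \<Rightarrow> complex" where
  "wp_term n j = (1 - q powi (2 * j + 1)) * theta_term n (Suc n) j"

lemma wp_term_eq_bailey_kernel:
  "wp_term n j = q powi tri j * bailey_kernel n n j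
    - q powi (tri j + 2 * j + 1) * bailey_kernel n n (j + 1)"
  "q ^ n * wp_term n j = q powi (tri j + j) * (bailey_kernel n n j - bailey_kernel n n (j + 1))"
proof -
  define y z where "y = q powi (int n - j)" and "z = q powi (2 * j + 1)"
  have yz: "q powi (int n + 1 + j) = y * z"
    and z: "q powi (tri j + 2 * j + 1) = q powi tri j * z"
    and y: "q powi (tri j + j) * y = q ^ n * q powi tri j"
    using q_nonzero by (simp_all add: y_def z_def add_ac flip: power_int_add power_int_of_nat)
  show "wp_term n j = q powi tri j * bailey_kernel n n j
      - q powi (tri j + 2 * j + 1) * bailey_kernel n n (j + 1)"
    unfolding wp_term_def theta_term_def bailey_kernel_lower_right[of n n j] yz z
      y_def[symmetric] z_def[symmetric]
    by algebra
  have "q powi (tri j + j) * (bailey_kernel n n j - bailey_kernel n n (j + 1))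
      = (q powi (tri j + j) * y) * (1 - z) * bailey_kernel n (Suc n) j"
    unfolding bailey_kernel_lower_right[of n n j] yz y_def[symmetric] by algebra
  then show "q ^ n * wp_term n j
      = q powi (tri j + j) * (bailey_kernel n n j - bailey_kernel n n (j + 1))"
    unfolding y by (simp add: wp_term_def theta_term_def z_def mult_ac)
qed

lemma wp_term_eq_0: "j < - int n - 1 \<or> int n < j \<Longrightarrow> wp_term n j = 0"
  by (simp add: wp_term_def theta_term_def bailey_kernel_eq_0 disj_imp)

lemma finite_wp_term: "finite {j. wp_term n j \<noteq> 0}"
  by (rule finite_subset[OF _ finite_theta_term]) (auto simp: wp_term_def)

lemma wp_term_sum_eq_theta_sums:
  assumes "x \<noteq> 0"
  shows "(\<Sum>j. x powi j * wp_term n j) = theta_sum n n x - theta_sum n n (x * q) / x"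
proof -
  define F where "F x j = x powi j * theta_term n n j" for x j
  have finite_F: "finite {j. F x j \<noteq> 0}" for x
    by (rule finite_subset[OF _ finite_theta_term[of n n]]) (auto simp: F_def)
  have summand: "x powi j * wp_term n j = F x j - F (x * q) (j + 1) / x" for j
  proof -
    have "q powi (tri j + 2 * j + 1) = q powi (j + 1) * q powi tri (j + 1)"
      unfolding tri_Suc using q_nonzero by (simp add: algebra_simps flip: power_int_add)
    then show ?thesis
      using assms by (simp add: wp_term_eq_bailey_kernel(1) F_def theta_term_def power_int_add_1
          power_int_mult_distrib right_diff_distrib)
  qed
  have "(\<Sum>j. x powi j * wp_term n j) = (\<Sum>j. F x j) - (\<Sum>j. F (x * q) (j + 1) / x)"
    unfolding summand using finite_F finite_support_shift[OF finite_F, of "x * q" 1] assms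
    by (simp add: Sum_any_diff)
  also have "(\<Sum>j. F (x * q) (j + 1) / x) = (\<Sum>j. F (x * q) j) / x"
    using finite_F[of "x * q"] Sum_any_shift[of "\<lambda>j. F (x * q) j / x" 1]
    by (simp add: divide_inverse Sum_any_left_distrib)
  finally show ?thesis
    by (simp add: theta_sum_def F_def)
qed

lemma wp_term_generating_function:
  assumes "x \<noteq> 0"
  shows "(\<Sum>j. x powi j * wp_term (Suc m) j)
    = (1 - 1 / x) * (1 + x) * (1 + 1 / x)
      * (qpoch (- (x * q)) q m * qpoch (- (q / x)) q m / qpoch q q (2 * Suc m))"
proof -
  define n where "n = Suc m"
  define B where "B = qpoch (- (x * q)) q m * qpoch (- (q / x)) q m / qpoch q q (2 * n)"
  have "theta_sum n n x = (1 + x) * (1 + q ^ n / x) * B"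
    unfolding finite_triple_product[OF assms] n_def qpoch_Suc_left[of "- x"]
      qpoch_Suc[of "- (q / x)"]
    by (simp add: B_def n_def mult_2)
  moreover have "theta_sum n n (x * q) = (1 + 1 / x) * (1 + x * q ^ n) * B"
    using assms q_nonzero finite_triple_product[of "x * q" n n]
    unfolding n_def qpoch_Suc_left[of "- (q / (x * q))"] qpoch_Suc[of "- (x * q)"]
    by (simp add: B_def n_def mult_2)
  moreover have "(1 + x) * (1 + q ^ n / x) * B - (1 + 1 / x) * (1 + x * q ^ n) * B / x
      = (1 - 1 / x) * (1 + x) * (1 + 1 / x) * B"
    using assms by (simp add: divide_simps) algebra
  ultimately show ?thesis
    using wp_term_sum_eq_theta_sums[OF assms, of n] by (simp only: B_def n_def)
qed

lemma wp_term_sum_multiples_of_4: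
  "(\<Sum>s. wp_term (Suc m) (4 * s)) = qpoch (- (q\<^sup>2)) (q\<^sup>2) m / qpoch q q (2 * Suc m)"
proof -
  define S where "S = (\<Sum>s. wp_term (Suc m) (4 * s))"
  define W where "W x = (\<Sum>j. x powi j * wp_term (Suc m) j)" for x
  define P where "P = qpoch (- (q\<^sup>2)) (q\<^sup>2) m"
  define Q where "Q = qpoch q q (2 * Suc m)"
  have product: "qpoch (\<i> * q) q m * qpoch (- (\<i> * q)) q m = P"
    "qpoch (- (\<i> * q)) q m * qpoch (\<i> * q) q m = P"
    using qpoch_mult_minus[of "\<i> * q" q m] by (simp_all add: P_def power_mult_distrib mult.commute)
  have W_eq: "W x = (1 - 1 / x) * (1 + x) * (1 + 1 / x)
      * (qpoch (- (x * q)) q m * qpoch (- (q / x)) q m / Q)"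
    if "x \<noteq> 0" for x
    unfolding W_def Q_def using that by (rule wp_term_generating_function)
  have "of_nat 4 * S = (\<Sum>k<4. W (\<i> ^ k))"
    unfolding S_def W_def of_nat_numeral[where 'a = int, symmetric]
  proof (rule roots_of_unity_filter)
    fix k :: nat
    assume "0 < k" "k < 4"
    then consider "k = 1" | "k = 2" | "k = 3" by linarith
    then show "\<i> ^ k \<noteq> 1" by cases (auto simp: power3_eq_cube complex_eq_iff)
  qed (simp_all add: finite_wp_term)
  also have "\<dots> = W 1 + W \<i> + W (- 1) + W (- \<i>)"
    by (simp add: eval_nat_numeral)
  also have "W 1 = 0"
    by (simp add: W_eq)
  also have "W (- 1) = 0"
    by (simp add: W_eq)
  also have "W \<i> = (1 - 1 / \<i>) * (1 + \<i>) * (1 + 1 / \<i>) * (P / Q)"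
    by (simp add: W_eq product)
  also have "W (- \<i>) = (1 + 1 / \<i>) * (1 - \<i>) * (1 - 1 / \<i>) * (P / Q)"
    by (simp add: W_eq product)
  also have "0 + (1 - 1 / \<i>) * (1 + \<i>) * (1 + 1 / \<i>) * (P / Q) + 0
      + (1 + 1 / \<i>) * (1 - \<i>) * (1 - 1 / \<i>) * (P / Q) = 4 * (P / Q)"
    by (simp add: algebra_simps flip: add_divide_distrib)
  finally have "S = P / Q"
    by (metis mult_left_cancel of_nat_numeral zero_neq_numeral)
  then show ?thesis
    by (simp add: P_def Q_def flip: S_def)
qed

lemma theta_term_ratio:
  "theta_term m n (j + 1) * (q powi (- int m) - q powi (int n - int m + 1 + j))
    = (q powi (j - int m) - 1) * theta_term m n j"
proof -
  define y where "y = q powi (int n + 1 + j)"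
  define z where "z = q powi (int m - j)"
  have y: "q powi (int n - int m + 1 + j) = q powi (- int m) * y"
    using q_nonzero by (simp add: y_def algebra_simps flip: power_int_add)
  have tri: "q powi tri (j + 1) * q powi (- int m) = q powi tri j * q powi (j - int m)"
    using q_nonzero by (simp add: tri_Suc add_diff_eq flip: power_int_add)
  have z: "q powi (j - int m) * z = 1"
    using q_nonzero by (simp add: z_def flip: power_int_add)
  have "theta_term m n (j + 1) * (q powi (- int m) - q powi (int n - int m + 1 + j))
      = (q powi tri (j + 1) * q powi (- int m)) * ((1 - y) * bailey_kernel m n (j + 1))"
    unfolding theta_term_def y by algebra
  also have "\<dots> = q powi tri j * (q powi (j - int m) * (1 - z)) * bailey_kernel m n j"
    unfolding tri y_def z_def bailey_kernel_ratio by (simp only: mult.assoc)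
  also have "q powi (j - int m) * (1 - z) = q powi (j - int m) - 1"
    by (simp add: right_diff_distrib z)
  finally show ?thesis
    by (simp add: theta_term_def)
qed

lemma theta_term_shift:
  "theta_term m n (j + int k) * (\<Prod>i<k. q powi (- int m) - q powi (int n - int m + 1 + (j + int i)))
    = (\<Prod>i<k. q powi (j + int i - int m) - 1) * theta_term m n j"
proof (induction k)
  case (Suc k)
  define D where "D i = q powi (- int m) - q powi (int n - int m + 1 + (j + int i))" for i
  define U where "U i = q powi (j + int i - int m) - 1" for i
  have "theta_term m n (j + int (Suc k)) * (\<Prod>i<Suc k. D i)
      = theta_term m n (j + int k + 1) * D k * (\<Prod>i<k. D i)"
    by (simp add: mult_ac add_ac)
  also have "\<dots> = U k * (theta_term m n (j + int k) * (\<Prod>i<k. D i))"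
    unfolding D_def theta_term_ratio by (simp only: U_def mult.assoc)
  also have "\<dots> = (\<Prod>i<Suc k. U i) * theta_term m n j"
    using Suc.IH by (simp add: D_def U_def)
  finally show ?case
    by (simp only: D_def U_def)
qed simp

lemma well_poised_theta_term:
  "well_poised (q ^ 4) q (q powi (- int n)) (q powi (1 - int n)) (q powi (2 - int n))
     (q powi (3 - int n)) (\<lambda>s. theta_term n (Suc n) (4 * s))"
proof (standard, goal_cases)
  case 1
  show ?case
    using q_nonzero by simp
next
  case 2
  show ?case
    using finite_vimageI[OF finite_theta_term[of n "Suc n"], of "(*) 4"]
    by (simp add: vimage_def inj_def)
next
  case (3 s)
  define y N where "y = q powi (4 * s)" and "N = q powi (- int n)"
  define t where "t k = theta_term n (Suc n) (4 * s + k)" for k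
  have params: "q powi (1 - int n) = q * N" "q powi (2 - int n) = q\<^sup>2 * N"
    "q powi (3 - int n) = q ^ 3 * N"
    using q_nonzero by (simp_all add: N_def power_int_diff power_int_minus_divide)
  have base: "(q ^ 4) powi s = y"
    by (simp add: y_def power_int_power)
  have base_Suc: "(q ^ 4) powi (s + 1) = q ^ 4 * y"
    using q_nonzero by (simp add: power_int_add_1' base)
  have "q powi (int (Suc n) - int n + 1 + (4 * s + int i)) = q ^ (i + 2) * y"
    "q powi (4 * s + int i - int n) = q ^ i * (N * y)" for i
  proof -
    have "int (Suc n) - int n + 1 + (4 * s + int i) = int (i + 2) + 4 * s"
      "4 * s + int i - int n = int i + (- int n + 4 * s)"
      by simp_all
    then show "q powi (int (Suc n) - int n + 1 + (4 * s + int i)) = q ^ (i + 2) * y"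
      "q powi (4 * s + int i - int n) = q ^ i * (N * y)"
      using q_nonzero by (simp_all only: y_def N_def power_int_add power_int_of_nat simp_thms)
  qed
  then have "t 4 * (\<Prod>i<4. N - q ^ (i + 2) * y) = (\<Prod>i<4. q ^ i * (N * y) - 1) * t 0"
    using theta_term_shift[of n "Suc n" "4 * s" 4]
    by (simp only: t_def N_def of_nat_numeral add_0_right)
  then have "t 4 * ((N - q\<^sup>2 * y) * (N - q ^ 3 * y) * (N - q ^ 4 * y) * (N - q ^ 5 * y))
      = (N * y - 1) * (q * (N * y) - 1) * (q\<^sup>2 * (N * y) - 1) * (q ^ 3 * (N * y) - 1) * t 0"
    by (simp add: numeral_eq_Suc mult.assoc)
  then have "t 4 * ((N - q * (q ^ 4 * y)) * (q * N - q * (q ^ 4 * y)) * (q\<^sup>2 * N - q * (q ^ 4 * y))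
      * (q ^ 3 * N - q * (q ^ 4 * y)))
    = q\<^sup>2 * q ^ 4 * ((1 - N * y) * (1 - q * N * y) * (1 - q\<^sup>2 * N * y) * (1 - q ^ 3 * N * y)) * t 0"
    by algebra
  then show ?case
    unfolding params base base_Suc N_def[symmetric] by (simp add: t_def)
qed

lemma wp_sum_K6:
  assumes "u \<noteq> 0" "v \<noteq> 0" "u \<noteq> 1" "u \<noteq> q" "v \<noteq> 1" "v \<noteq> q"
  shows "(\<Sum>s. wp_quot (q ^ 4) q u v s / q powi (8 * s) * wp_term n (4 * s))
    = K6 q u v n * (\<Sum>s. wp_term n (4 * s))"
proof (cases "n \<le> 2")
  case True
    \<comment> \<open>Only \<open>s = 0\<close> contributes, which is why \<open>K6\<close> is 1 here.\<close>
  have only_0: "(\<Sum>s. h s * wp_term n (4 * s)) = h 0 * wp_term n 0" for h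
  proof -
    have "h s * wp_term n (4 * s) = (if s = 0 then h s * wp_term n (4 * s) else 0)" for s
      using True by (auto intro!: wp_term_eq_0)
    then have "(\<Sum>s. h s * wp_term n (4 * s)) = (\<Sum>s. if s = 0 then h s * wp_term n (4 * s) else 0)"
      by (rule Sum_any.cong)
    then show ?thesis
      by simp
  qed
  have "(\<Sum>s. wp_quot (q ^ 4) q u v s / q powi (8 * s) * wp_term n (4 * s))
      = wp_quot (q ^ 4) q u v 0 * (\<Sum>s. wp_term n (4 * s))"
    using only_0[of "\<lambda>s. wp_quot (q ^ 4) q u v s / q powi (8 * s)"] only_0[of "\<lambda>_. 1"] by simp
  then show ?thesis
    using True by (simp only: wp_quot_0[OF assms(3-)] K6_def if_True)
next
  case False
  interpret well_poised "q ^ 4" q "q powi (- int n)" "q powi (1 - int n)" "q powi (2 - int n)"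
      "q powi (3 - int n)" "\<lambda>s. theta_term n (Suc n) (4 * s)"
    by (rule well_poised_theta_term)
  have node_squared: "((q ^ 4) powi s)\<^sup>2 = q powi (8 * s)" for s
    by (simp add: power_int_power power_int_power')
  have vwp_term_eq: "vwp_term s = wp_term n (4 * s)" for s
    using q_nonzero by (simp add: vwp_term_def wp_term_def node_squared power_int_add_1')
  have "\<sigma>4 = q powi (6 - 4 * int n)" "\<sigma>4 * q powi 4 = q powi (10 - 4 * int n)"
    using q_nonzero by (simp_all add: \<sigma>4_def flip: power_int_add del: power_int_numeral)
  then have "q\<^sup>2 \<noteq> \<sigma>4" "q\<^sup>2 \<noteq> \<sigma>4 * q ^ 4"
    using False powi_eq_iff[of 2 "6 - 4 * int n"] powi_eq_iff[of 2 "10 - 4 * int n"]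
    by (simp_all add: power_int_numeral)
  from well_poised_sum_K[OF this assms] show ?thesis
    by (simp only: node_squared vwp_term_eq K6_def False if_False)
qed

lemma wp_term_4_eq_bailey_kernel:
  "wp_term n (4 * s) / q powi (8 * s)
    = q powi (8 * s\<^sup>2 - 10 * s) * bailey_kernel n n (4 * s)
      - q powi (8 * s\<^sup>2 - 2 * s + 1) * bailey_kernel n n (4 * s + 1)"
  "q ^ n * wp_term n (4 * s) / q powi (8 * s)
    = q powi (8 * s\<^sup>2 - 6 * s) * bailey_kernel n n (4 * s)
      - q powi (8 * s\<^sup>2 - 6 * s) * bailey_kernel n n (4 * s + 1)"
proof -
  have exponents: "8 * s\<^sup>2 - 10 * s = tri (4 * s) - 8 * s"
    "8 * s\<^sup>2 - 6 * s = tri (4 * s) + 4 * s - 8 * s"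
    "8 * s\<^sup>2 - 2 * s + 1 = tri (4 * s) + 2 * (4 * s) + 1 - 8 * s"
    by (simp_all add: tri_4)
  have quotient: "q powi (k - l) = q powi k / q powi l" for k l
    using q_nonzero by (simp add: power_int_diff)
  show "wp_term n (4 * s) / q powi (8 * s)
      = q powi (8 * s\<^sup>2 - 10 * s) * bailey_kernel n n (4 * s)
        - q powi (8 * s\<^sup>2 - 2 * s + 1) * bailey_kernel n n (4 * s + 1)"
    unfolding exponents quotient wp_term_eq_bailey_kernel(1)
    by (simp only: diff_divide_distrib times_divide_eq_left)
  show "q ^ n * wp_term n (4 * s) / q powi (8 * s)
      = q powi (8 * s\<^sup>2 - 6 * s) * bailey_kernel n n (4 * s)
        - q powi (8 * s\<^sup>2 - 6 * s) * bailey_kernel n n (4 * s + 1)"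
    unfolding exponents quotient wp_term_eq_bailey_kernel(2)
    by (simp only: right_diff_distrib diff_divide_distrib times_divide_eq_left)
qed

end

subsection \<open>The Bailey pairs\<close>

definition folded_mod_4 :: "(nat \<Rightarrow> complex) \<Rightarrow> (int \<Rightarrow> complex) \<Rightarrow> (int \<Rightarrow> complex) \<Rightarrow> bool" where
  "folded_mod_4 \<alpha> g h \<longleftrightarrow>
     \<alpha> 0 = g 0 \<and> (\<forall>r. \<alpha> (4 * r + 2) = 0) \<and>
     (\<forall>r\<ge>1. \<alpha> (4 * r) = g (int r) + g (- int r)) \<and>
     (\<forall>r. \<alpha> (4 * r + 1) = - h (int r)) \<and>
     (\<forall>r\<ge>1. \<alpha> (4 * r - 1) = - h (- int r))"

lemma folded_mod_4_0:
  assumes "folded_mod_4 \<alpha> g h"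
  shows "\<alpha> 0 = g 0" "\<alpha> 1 = - h 0"
proof -
  show "\<alpha> 0 = g 0"
    using assms unfolding folded_mod_4_def by blast
  have "\<alpha> (4 * 0 + 1) = - h (int 0)"
    using assms unfolding folded_mod_4_def by blast
  then show "\<alpha> 1 = - h 0"
    by simp
qed

lemma folded_mod_4_Suc:
  assumes "folded_mod_4 \<alpha> g h"
  shows "\<alpha> (4 * r + 2) = 0" "\<alpha> (4 * r + 3) = - h (- int (Suc r))"
    "\<alpha> (4 * r + 4) = g (int (Suc r)) + g (- int (Suc r))" "\<alpha> (4 * r + 5) = - h (int (Suc r))"
proof -
  have index: "4 * r + 3 = 4 * Suc r - 1" "4 * r + 4 = 4 * Suc r" "4 * r + 5 = 4 * Suc r + 1"
    and "Suc r \<ge> 1"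
    by simp_all
  then show "\<alpha> (4 * r + 2) = 0" "\<alpha> (4 * r + 3) = - h (- int (Suc r))"
    "\<alpha> (4 * r + 4) = g (int (Suc r)) + g (- int (Suc r))" "\<alpha> (4 * r + 5) = - h (int (Suc r))"
    using assms unfolding folded_mod_4_def index by blast+
qed

context non_root_of_unity
begin

lemma bailey_pair_1_iff:
  "bailey_pair q 1 \<alpha> \<beta> \<longleftrightarrow> \<alpha> 0 = 1 \<and> (\<forall>n. \<beta> n = (\<Sum>j\<le>n. \<alpha> j * bailey_kernel n n (int j)))"
proof -
  have "\<alpha> j * bailey_kernel n n (int j) = \<alpha> j / (qpoch q q (n - j) * qpoch q q (n + j))"
    if "j \<le> n" for n j
    using inv_qfact_of_nat[of "n - j"] inv_qfact_of_nat[of "n + j"] that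
    by (simp add: bailey_kernel_def of_nat_diff)
  then show ?thesis
    by (simp add: bailey_pair_def)
qed

lemma bailey_sum_folded:
  assumes "folded_mod_4 \<alpha> g h"
  shows "(\<Sum>j\<le>n. \<alpha> j * bailey_kernel n n (int j))
    = (\<Sum>s. g s * bailey_kernel n n (4 * s) - h s * bailey_kernel n n (4 * s + 1))"
proof -
  define a where "a j = \<alpha> j * bailey_kernel n n (int j)" for j
  define F where "F s = g s * bailey_kernel n n (4 * s) - h s * bailey_kernel n n (4 * s + 1)" for s
  have "(\<Sum>j\<le>n. a j) = (\<Sum>j\<le>4 * n + 1. a j)"
    by (rule sum.mono_neutral_left) (auto simp: a_def bailey_kernel_eq_0)
  also have "\<dots> = (\<Sum>s\<in>{- int n..int n}. F s)"
  proof (rule sum_blocks_of_4_eq_int_sum)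
    show "F 0 = a 0 + a 1"
      using folded_mod_4_0[OF assms] by (simp add: F_def a_def)
    fix r :: nat
    have "bailey_kernel n n (4 * - int (Suc r)) = bailey_kernel n n (int (4 * r + 4))"
      "bailey_kernel n n (4 * - int (Suc r) + 1) = bailey_kernel n n (int (4 * r + 3))"
      using bailey_kernel_minus[of n n "int (4 * r + 4)"]
        bailey_kernel_minus[of n n "int (4 * r + 3)"]
      by (simp_all add: algebra_simps)
    then show "F (int (Suc r)) + F (- int (Suc r))
        = a (4 * r + 2) + a (4 * r + 3) + a (4 * r + 4) + a (4 * r + 5)"
      unfolding F_def a_def folded_mod_4_Suc[OF assms] by (simp add: algebra_simps)
  qed
  also have "\<dots> = (\<Sum>s. F s)"
  proof (rule Sum_any.expand_superset[symmetric])
    have "F s = 0" if "s \<notin> {- int n..int n}" for s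
    proof -
      have "4 * s < - int n \<or> int n < 4 * s" "4 * s + 1 < - int n \<or> int n < 4 * s + 1"
        using that unfolding atLeastAtMost_iff by linarith+
      then show ?thesis
        by (simp add: F_def bailey_kernel_eq_0)
    qed
    then show "{s. F s \<noteq> 0} \<subseteq> {- int n..int n}"
      by blast
  qed simp
  finally show ?thesis
    by (simp add: a_def F_def)
qed

theorem bailey_pair_of_folded:
  assumes folded: "folded_mod_4 \<alpha> (\<lambda>s. wp_quot (q ^ 4) q u v s * x s)
      (\<lambda>s. wp_quot (q ^ 4) q u v s * y s)"
    and weights: "\<And>n s. x s * bailey_kernel n n (4 * s) - y s * bailey_kernel n n (4 * s + 1)
      = scale n * wp_term n (4 * s) / q powi (8 * s)"
    and init: "\<alpha> 0 = 1" "\<beta> 0 = 1"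
    and uv: "u \<noteq> 0" "v \<noteq> 0" "u \<noteq> 1" "u \<noteq> q" "v \<noteq> 1" "v \<noteq> q"
    and \<beta>: "\<forall>n\<ge>1. \<beta> n = K6 q u v n * (scale n * qpoch (- (q\<^sup>2)) (q\<^sup>2) (n - 1) / qpoch q q (2 * n))"
  shows "bailey_pair q 1 \<alpha> \<beta>"
  unfolding bailey_pair_1_iff
proof (intro conjI allI)
  fix n
  show "\<beta> n = (\<Sum>j\<le>n. \<alpha> j * bailey_kernel n n (int j))"
  proof (cases n)
    case 0
    then show ?thesis
      using init inv_qfact_of_nat[of 0] by (simp add: bailey_kernel_def)
  next
    case (Suc m)
    define R where "R s = wp_quot (q ^ 4) q u v s / q powi (8 * s) * wp_term n (4 * s)" for s
    have "finite {s. wp_term n (4 * s) \<noteq> 0}"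
      using finite_vimageI[OF finite_wp_term[of n], of "(*) 4"] by (simp add: vimage_def inj_def)
    then have "finite {s. R s \<noteq> 0}"
      by (rule rev_finite_subset) (auto simp: R_def)
    moreover have "wp_quot (q ^ 4) q u v s * x s * bailey_kernel n n (4 * s)
        - wp_quot (q ^ 4) q u v s * y s * bailey_kernel n n (4 * s + 1) = scale n * R s" for s
    proof -
      have "wp_quot (q ^ 4) q u v s * x s * bailey_kernel n n (4 * s)
          - wp_quot (q ^ 4) q u v s * y s * bailey_kernel n n (4 * s + 1)
        = wp_quot (q ^ 4) q u v s
          * (x s * bailey_kernel n n (4 * s) - y s * bailey_kernel n n (4 * s + 1))"
        by (simp only: right_diff_distrib mult.assoc)
      then show ?thesis
        unfolding weights by (simp add: R_def)
    qed
    ultimately have "(\<Sum>j\<le>n. \<alpha> j * bailey_kernel n n (int j)) = scale n * (\<Sum>s. R s)"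
      unfolding bailey_sum_folded[OF folded] by (simp only: Sum_any_right_distrib)
    also have "(\<Sum>s. R s) = K6 q u v n * (qpoch (- (q\<^sup>2)) (q\<^sup>2) m / qpoch q q (2 * Suc m))"
      unfolding R_def wp_sum_K6[OF uv] Suc wp_term_sum_multiples_of_4 ..
    also have "scale n * \<dots> = \<beta> n"
      using \<beta> Suc by simp
    finally show ?thesis ..
  qed
qed (rule init)

end

lemma generic_params_imp_non_root_of_unity:
  assumes "generic_params q u v"
  shows "non_root_of_unity q"
proof
  show "q \<noteq> 0" using assms by (simp add: generic_params_def)
  fix k :: nat assume "k \<ge> 1"
  then obtain m where "k = Suc m" by (cases k) auto
  moreover have "qpoch q q (Suc m) \<noteq> 0" using assms by (simp add: generic_params_def)
  ultimately show "q ^ k \<noteq> 1" by (auto simp: qpoch_def)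
qed

lemma generic_params_neq:
  assumes "generic_params q u v"
  shows "u \<noteq> 0" "v \<noteq> 0" "u \<noteq> 1" "u \<noteq> q" "v \<noteq> 1" "v \<noteq> q"
proof -
  show nonzero: "u \<noteq> 0" "v \<noteq> 0"
    using assms by (simp_all add: generic_params_def)
  have "qpochs [u, v, q / u, q / v] (q ^ 4) 1 \<noteq> 0"
    using assms unfolding generic_params_def by blast
  then show "u \<noteq> 1" "u \<noteq> q" "v \<noteq> 1" "v \<noteq> q"
    using nonzero by (auto simp: qpochs_def qpoch_def)
qed

lemma shift_quot_eq_qpoch_quot:
  assumes "qpoch x p r \<noteq> 0" "x \<noteq> 1"
  shows "qpoch (x * p) p r / qpoch x p r = shift_quot p x (int r)"
proof -
  have "(1 - x) * qpoch (x * p) p r = qpoch x p r * (1 - x * p ^ r)"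
    by (simp flip: qpoch_Suc qpoch_Suc_left)
  then show ?thesis
    using assms by (simp add: shift_quot_def field_simps)
qed

lemma qpochs_quot_eq_prod_shift_quot:
  assumes "qpochs xs p r \<noteq> 0" "1 \<notin> set xs"
  shows "qpochs (map (\<lambda>x. x * p) xs) p r / qpochs xs p r = (\<Prod>x\<leftarrow>xs. shift_quot p x (int r))"
  using assms
proof (induction xs)
  case (Cons x xs)
  then show ?case
    by (simp add: qpochs_def flip: shift_quot_eq_qpoch_quot times_divide_times_eq)
qed (simp add: qpochs_def)

lemma G_eq_wp_quot:
  assumes "generic_params q u v"
  shows "G q u v r = wp_quot (q ^ 4) q u v (int r)"
proof -
  let ?xs = "[u, v, q / u, q / v]"
  have shifted: "[q ^ 4 * u, q ^ 4 * v, q ^ 5 / u, q ^ 5 / v] = map (\<lambda>x. x * q ^ 4) ?xs"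
    by (simp add: eval_nat_numeral)
  have "qpochs ?xs (q ^ 4) r \<noteq> 0" "1 \<notin> set ?xs"
    using assms generic_params_neq[OF assms] unfolding generic_params_def by auto
  then have "G q u v r = (\<Prod>x\<leftarrow>?xs. shift_quot (q ^ 4) x (int r))"
    unfolding G_def shifted by (rule qpochs_quot_eq_prod_shift_quot)
  then show ?thesis
    by (simp add: wp_quot_def mult.assoc)
qed

lemma H_eq_wp_quot:
  assumes "generic_params q u v"
  shows "H q u v r = q powi (16 * int r) * wp_quot (q ^ 4) q u v (- int r)"
proof -
  let ?xs = "[1 / (q / u), 1 / (q / v), 1 / u, 1 / v]"
  have nonzero: "q \<noteq> 0" "u \<noteq> 0" "v \<noteq> 0"
    using assms by (simp_all add: generic_params_def)
  have shifted: "[q ^ 3 * u, q ^ 3 * v, q ^ 4 / u, q ^ 4 / v] = map (\<lambda>x. x * q ^ 4) ?xs"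
    using nonzero by (simp add: eval_nat_numeral)
  have inverses: "[u / q, v / q, 1 / u, 1 / v] = ?xs"
    by simp
  have "qpochs ?xs (q ^ 4) r \<noteq> 0" "1 \<notin> set ?xs"
    using assms generic_params_neq[OF assms] unfolding generic_params_def by auto
  then have "H q u v r = (\<Prod>x\<leftarrow>?xs. shift_quot (q ^ 4) x (int r))"
    unfolding H_def shifted inverses by (rule qpochs_quot_eq_prod_shift_quot)
  also have "\<dots> = ((q ^ 4) powi int r) ^ 4 * wp_quot (q ^ 4) q u v (- int r)"
    using nonzero by (simp add: shift_quot_inverse wp_quot_def power4_eq_xxxx mult_ac
        del: divide_divide_eq_right)
  also have "((q ^ 4) powi int r) ^ 4 = q powi (16 * int r)"
    by (simp only: power_int_power power_int_power') simp
  finally show ?thesis .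
qed

lemma folded_mod_4_G_H:
  assumes "generic_params q u v"
    and \<alpha>: "\<alpha> 0 = 1" "\<forall>r. \<alpha> (4 * r + 2) = 0"
      "\<forall>r\<ge>1. \<alpha> (4 * r) = G q u v r * q powi (8 * (int r)\<^sup>2 - i * int r)
        + H q u v r * q powi (8 * (int r)\<^sup>2 - (16 - i) * int r)"
      "\<forall>r. \<alpha> (4 * r + 1) = - G q u v r * q powi (8 * (int r)\<^sup>2 - j * int r + k)"
      "\<forall>r\<ge>1. \<alpha> (4 * r - 1) = - H q u v r * q powi (8 * (int r)\<^sup>2 - (16 - j) * int r + k)"
  shows "folded_mod_4 \<alpha> (\<lambda>s. wp_quot (q ^ 4) q u v s * q powi (8 * s\<^sup>2 - i * s))
    (\<lambda>s. wp_quot (q ^ 4) q u v s * q powi (8 * s\<^sup>2 - j * s + k))"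
proof -
  have "q \<noteq> 0"
    using assms(1) by (simp add: generic_params_def)
  have reflect: "H q u v r * q powi (8 * (int r)\<^sup>2 - (16 - l) * int r + k)
      = wp_quot (q ^ 4) q u v (- int r) * q powi (8 * (- int r)\<^sup>2 - l * - int r + k)" for r l k
  proof -
    have "8 * (- int r)\<^sup>2 - l * - int r + k = 16 * int r + (8 * (int r)\<^sup>2 - (16 - l) * int r + k)"
      by (simp add: algebra_simps)
    then show ?thesis
      using \<open>q \<noteq> 0\<close> by (simp only: H_eq_wp_quot[OF assms(1)] power_int_add mult_ac simp_thms)
  qed
  show ?thesis
    unfolding folded_mod_4_def
  proof (intro conjI allI impI)
    show "\<alpha> 0 = wp_quot (q ^ 4) q u v 0 * q powi (8 * 0\<^sup>2 - i * 0)"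
      using \<alpha>(1) wp_quot_0[OF generic_params_neq(3-)[OF assms(1)]] by simp
  next
    fix r :: nat
    show "\<alpha> (4 * r + 2) = 0"
      using \<alpha>(2) by blast
    show "\<alpha> (4 * r + 1)
        = - (wp_quot (q ^ 4) q u v (int r) * q powi (8 * (int r)\<^sup>2 - j * int r + k))"
      using \<alpha>(4) by (simp only: G_eq_wp_quot[OF assms(1)] mult_minus_left)
    assume "r \<ge> 1"
    then show "\<alpha> (4 * r) = wp_quot (q ^ 4) q u v (int r) * q powi (8 * (int r)\<^sup>2 - i * int r)
        + wp_quot (q ^ 4) q u v (- int r) * q powi (8 * (- int r)\<^sup>2 - i * - int r)"
      using \<alpha>(3) reflect[of r i 0] by (simp only: G_eq_wp_quot[OF assms(1)] add_0_right)
    show "\<alpha> (4 * r - 1)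
        = - (wp_quot (q ^ 4) q u v (- int r) * q powi (8 * (- int r)\<^sup>2 - j * - int r + k))"
      using \<alpha>(5) \<open>r \<ge> 1\<close> by (simp only: mult_minus_left reflect)
  qed
qed

notation suminf (binder "\<Sum>" 10)

theorem theorem2p14:
  fixes q u v :: complex
  assumes "generic_params q u v"
  shows
    "(\<forall>\<alpha> \<beta> :: nat \<Rightarrow> complex.
        \<alpha> 0 = 1 \<and> \<beta> 0 = 1 \<and>
        (\<forall>r. \<alpha> (4 * r + 2) = 0) \<and>
        (\<forall>r\<ge>1. \<alpha> (4 * r) = G q u v r * q powi (8 * (int r)\<^sup>2 - 10 * int r)
                          + H q u v r * q powi (8 * (int r)\<^sup>2 - 6 * int r)) \<and>
        (\<forall>r. \<alpha> (4 * r + 1) = - G q u v r * q powi (8 * (int r)\<^sup>2 - 2 * int r + 1)) \<and>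
        (\<forall>r\<ge>1. \<alpha> (4 * r - 1) = - H q u v r * q powi (8 * (int r)\<^sup>2 - 14 * int r + 1)) \<and>
        (\<forall>n\<ge>1. \<beta> n = K6 q u v n * (qpoch (- (q\<^sup>2)) (q\<^sup>2) (n - 1) / qpoch q q (2 * n)))
        \<longrightarrow> bailey_pair q 1 \<alpha> \<beta>)
     \<and>
     (\<forall>\<alpha> \<beta> :: nat \<Rightarrow> complex.
        \<alpha> 0 = 1 \<and> \<beta> 0 = 1 \<and>
        (\<forall>r. \<alpha> (4 * r + 2) = 0) \<and>
        (\<forall>r\<ge>1. \<alpha> (4 * r) = G q u v r * q powi (8 * (int r)\<^sup>2 - 6 * int r)
                          + H q u v r * q powi (8 * (int r)\<^sup>2 - 10 * int r)) \<and>
        (\<forall>r. \<alpha> (4 * r + 1) = - G q u v r * q powi (8 * (int r)\<^sup>2 - 6 * int r)) \<and>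
        (\<forall>r\<ge>1. \<alpha> (4 * r - 1) = - H q u v r * q powi (8 * (int r)\<^sup>2 - 10 * int r)) \<and>
        (\<forall>n\<ge>1. \<beta> n = K6 q u v n
                        * (q ^ n * qpoch (- (q\<^sup>2)) (q\<^sup>2) (n - 1) / qpoch q q (2 * n)))
        \<longrightarrow> bailey_pair q 1 \<alpha> \<beta>)"
proof -
  interpret non_root_of_unity q
    using assms by (rule generic_params_imp_non_root_of_unity)
  note neq = generic_params_neq[OF assms]
  show ?thesis
  proof (intro conjI allI impI, goal_cases)
    case (1 \<alpha> \<beta>)
    then have "folded_mod_4 \<alpha> (\<lambda>s. wp_quot (q ^ 4) q u v s * q powi (8 * s\<^sup>2 - 10 * s))
        (\<lambda>s. wp_quot (q ^ 4) q u v s * q powi (8 * s\<^sup>2 - 2 * s + 1))"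
      using folded_mod_4_G_H[OF assms, of \<alpha> 10 2 1] by simp
    then show ?case
      by (rule bailey_pair_of_folded[OF _ _ _ _ neq, where scale = "\<lambda>_. 1"])
        (simp_all add: 1 wp_term_4_eq_bailey_kernel)
  next
    case (2 \<alpha> \<beta>)
    then have "folded_mod_4 \<alpha> (\<lambda>s. wp_quot (q ^ 4) q u v s * q powi (8 * s\<^sup>2 - 6 * s))
        (\<lambda>s. wp_quot (q ^ 4) q u v s * q powi (8 * s\<^sup>2 - 6 * s))"
      using folded_mod_4_G_H[OF assms, of \<alpha> 6 6 0] by simp
    then show ?case
      by (rule bailey_pair_of_folded[OF _ _ _ _ neq, where scale = "\<lambda>n. q ^ n"])
        (simp_all add: 2 wp_term_4_eq_bailey_kernel)
  qed
qed

end
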